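(* $\mathbf{PAFKy}$ and $\mathbf{ELKy^r}$ are not equally expressive (over $\mathcal{S}5$ knowing-why models); in particular, there is a formula of $\mathcal{L}_{PAFKy}$ that is not equivalent to any formula of $\mathcal{L}_{ELKy^r}$.
   Context: Fix a countable set of agents $\mathcal{A}$ and a countably infinite set of atoms $\mathcal{P}$. $\mathcal{L}_{PAFKy}$: $\phi ::= p\mid\neg\phi\mid(\phi\land\phi)\mid K_a\phi\mid Ky_a\phi\mid[\phi]\phi$; $\mathcal{L}_{ELKy^r}$: $\phi ::= p\mid\neg\phi\mid(\phi\land\phi)\mid K_a\phi\mid Ky_a^r(\phi,\phi)$. Let $\mathcal{L}$ be the set of formulas built with all these constructs. $\Lambda$ is a fixed set of valid formulas (tautology ground). An $\mathcal{S}5$ knowing-why model is $\mathfrak{M}=\langle W,E,\{R_a\}_{a\in\mathcal{A}},\mathcal{E},V\rangle$ with $W\neq\emptyset$; $E$ nonempty, containing a designated $e$, closed under a binary operation $\cdot$; each $R_a$ an equivalence relation on $W$; $\mathcal{E}:E\times\mathcal{L}\to 2^W$ with $\mathcal{E}(e,\phi)=W$ for $\phi\in\Lambda$ and $\mathcal{E}(s,\phi\to\psi)\cap\mathcal{E}(t,\phi)\subseteq\mathcal{E}(s\cdot t,\psi)$; $V:\mathcal{P}\to 2^W$. Truth: $p,\neg,\land$ as usual; $K_a\phi$ holds at $w$ iff $\phi$ holds at all $R_a$-successors; $Ky_a\phi$ holds at $w$ iff $K_a\phi$ holds at $w$ and there is $t\in E$ with $v\in\mathcal{E}(t,\phi)$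 for all $R_a$-successors $v$; $Ky_a^r(\phi,\psi)$ holds at $w$ iff there is $t\in E$ such that every $v$ with $(w,v)\in R_a$ and $(\mathfrak{M},v)\models\phi$ satisfies $v\in\mathcal{E}(t,\psi)$ and $(\mathfrak{M},v)\models\psi$; $(\mathfrak{M},w)\models[\phi]\psi$ iff $(\mathfrak{M},w)\models\phi$ implies $(\mathfrak{M}|\phi,w)\models\psi$, where $\mathfrak{M}|\phi$ restricts $W$ to $W'=\{w\mid(\mathfrak{M},w)\models\phi\}$, $R_a$ to $R_a\cap(W'\times W')$, $V(p)$ to $V(p)\cap W'$ and $\mathcal{E}(t,\chi)$ to $\mathcal{E}(t,\chi)\cap W'$, keeping $E$. Two formulas are equivalent if they hold at exactly the same pointed models. Two logics are equally expressive if every formula of each is equivalent to some formula of the other. *)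

theory Defs
  imports
    "HOL-Library.Countable"
    "HOL-Library.Infinite_Typeclass"
begin

text \<open>
  Agents and atoms are the elements of the types \<open>'a\<close> and \<open>'p\<close>; the full language is the
  whole type \<open>('a, 'p) fm\<close>.
\<close>

datatype ('a, 'p) fm =
    Atom 'p
  | Neg "('a, 'p) fm"
  | Conj "('a, 'p) fm" "('a, 'p) fm"
  | K 'a "('a, 'p) fm"
  | Ky 'a "('a, 'p) fm"
  | KyR 'a "('a, 'p) fm" "('a, 'p) fm"
  | Ann "('a, 'p) fm" "('a, 'p) fm"

abbreviation Imp :: "('a, 'p) fm \<Rightarrow> ('a, 'p) fm \<Rightarrow> ('a, 'p) fm" where
  "Imp \<phi> \<psi> \<equiv> Neg (Conj \<phi> (Neg \<psi>))"

inductive_set L_PAFKy :: "('a, 'p) fm set" where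
  "Atom p \<in> L_PAFKy"
| "\<phi> \<in> L_PAFKy \<Longrightarrow> Neg \<phi> \<in> L_PAFKy"
| "\<phi> \<in> L_PAFKy \<Longrightarrow> \<psi> \<in> L_PAFKy \<Longrightarrow> Conj \<phi> \<psi> \<in> L_PAFKy"
| "\<phi> \<in> L_PAFKy \<Longrightarrow> K a \<phi> \<in> L_PAFKy"
| "\<phi> \<in> L_PAFKy \<Longrightarrow> Ky a \<phi> \<in> L_PAFKy"
| "\<phi> \<in> L_PAFKy \<Longrightarrow> \<psi> \<in> L_PAFKy \<Longrightarrow> Ann \<phi> \<psi> \<in> L_PAFKy"

inductive_set L_ELKyR :: "('a, 'p) fm set" where
  "Atom p \<in> L_ELKyR"
| "\<phi> \<in> L_ELKyR \<Longrightarrow> Neg \<phi> \<in> L_ELKyR"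
| "\<phi> \<in> L_ELKyR \<Longrightarrow> \<psi> \<in> L_ELKyR \<Longrightarrow> Conj \<phi> \<psi> \<in> L_ELKyR"
| "\<phi> \<in> L_ELKyR \<Longrightarrow> K a \<phi> \<in> L_ELKyR"
| "\<phi> \<in> L_ELKyR \<Longrightarrow> \<psi> \<in> L_ELKyR \<Longrightarrow> KyR a \<phi> \<psi> \<in> L_ELKyR"

record ('w, 'e, 'a, 'p) model =
  worlds :: "'w set"
  expls :: "'e set"
  unit_expl :: 'e
  app :: "'e \<Rightarrow> 'e \<Rightarrow> 'e"
  acc :: "'a \<Rightarrow> ('w \<times> 'w) set"
  adm :: "'e \<Rightarrow> ('a, 'p) fm \<Rightarrow> 'w set"
  val :: "'p \<Rightarrow> 'w set"

text \<open>
  The carriers \<open>worlds\<close> and \<open>expls\<close> are arbitrary subsets of \<open>'w\<close> and \<open>'e\<close>. For countable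
  \<open>'a\<close> and \<open>'p\<close>, validity and equivalence over models of any cardinality are determined by
  models with countable carriers (Skolem hulls), so any infinite \<open>'w\<close> and \<open>'e\<close> yield the
  absolute notions.
\<close>

definition S5_models :: "('a, 'p) fm set \<Rightarrow> ('w, 'e, 'a, 'p) model set" where
  "S5_models \<Lambda> = {M.
     worlds M \<noteq> {} \<and>
     unit_expl M \<in> expls M \<and>
     (\<forall>s\<in>expls M. \<forall>t\<in>expls M. app M s t \<in> expls M) \<and>
     (\<forall>a. equiv (worlds M) (acc M a)) \<and>
     (\<forall>t\<in>expls M. \<forall>\<phi>. adm M t \<phi> \<subseteq> worlds M) \<and>
     (\<forall>\<phi>\<in>\<Lambda>. adm M (unit_expl M) \<phi> = worlds M) \<and>
     (\<forall>s\<in>expls M. \<forall>t\<in>expls M. \<forall>\<phi> \<psi>.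
        adm M s (Imp \<phi> \<psi>) \<inter> adm M t \<phi> \<subseteq> adm M (app M s t) \<psi>) \<and>
     (\<forall>p. val M p \<subseteq> worlds M)}"

definition restrict_model ::
    "('w, 'e, 'a, 'p) model \<Rightarrow> 'w set \<Rightarrow> ('w, 'e, 'a, 'p) model" where
  "restrict_model M W' = M\<lparr>
     worlds := W',
     acc := (\<lambda>a. acc M a \<inter> W' \<times> W'),
     adm := (\<lambda>t \<chi>. adm M t \<chi> \<inter> W'),
     val := (\<lambda>p. val M p \<inter> W')\<rparr>"

primrec sat :: "('a, 'p) fm \<Rightarrow> ('w, 'e, 'a, 'p) model \<Rightarrow> 'w \<Rightarrow> bool" where
  "sat (Atom p) M w \<longleftrightarrow> w \<in> val M p"
| "sat (Neg \<phi>) M w \<longleftrightarrow> \<not> sat \<phi> M w"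
| "sat (Conj \<phi> \<psi>) M w \<longleftrightarrow> sat \<phi> M w \<and> sat \<psi> M w"
| "sat (K a \<phi>) M w \<longleftrightarrow> (\<forall>v. (w, v) \<in> acc M a \<longrightarrow> sat \<phi> M v)"
| "sat (Ky a \<phi>) M w \<longleftrightarrow>
     (\<forall>v. (w, v) \<in> acc M a \<longrightarrow> sat \<phi> M v) \<and>
     (\<exists>t\<in>expls M. \<forall>v. (w, v) \<in> acc M a \<longrightarrow> v \<in> adm M t \<phi>)"
| "sat (KyR a \<phi> \<psi>) M w \<longleftrightarrow>
     (\<exists>t\<in>expls M. \<forall>v. (w, v) \<in> acc M a \<and> sat \<phi> M v \<longrightarrow>
        v \<in> adm M t \<psi> \<and> sat \<psi> M v)"
| "sat (Ann \<phi> \<psi>) M w \<longleftrightarrow>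
     (sat \<phi> M w \<longrightarrow> sat \<psi> (restrict_model M {v \<in> worlds M. sat \<phi> M v}) w)"

definition valid_over :: "('w, 'e, 'a, 'p) model set \<Rightarrow> ('a, 'p) fm \<Rightarrow> bool" where
  "valid_over C \<phi> \<longleftrightarrow> (\<forall>M\<in>C. \<forall>w\<in>worlds M. sat \<phi> M w)"

definition equivalent_over ::
    "('w, 'e, 'a, 'p) model set \<Rightarrow> ('a, 'p) fm \<Rightarrow> ('a, 'p) fm \<Rightarrow> bool" where
  "equivalent_over C \<phi> \<psi> \<longleftrightarrow> (\<forall>M\<in>C. \<forall>w\<in>worlds M. sat \<phi> M w \<longleftrightarrow> sat \<psi> M w)"

definition equally_expressive_over ::
    "('w, 'e, 'a, 'p) model set \<Rightarrow> ('a, 'p) fm set \<Rightarrow> ('a, 'p) fm set \<Rightarrow> bool" where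
  "equally_expressive_over C L1 L2 \<longleftrightarrow>
     (\<forall>\<phi>\<in>L1. \<exists>\<psi>\<in>L2. equivalent_over C \<phi> \<psi>) \<and>
     (\<forall>\<psi>\<in>L2. \<exists>\<phi>\<in>L1. equivalent_over C \<psi> \<phi>)"

end

theory Submission
  imports Defs
begin

text \<open>
  The formula \<open>Ky\<^sup>r\<^sub>a(\<phi>, \<psi>)\<close> asks for explanations of \<open>\<psi>\<close> only at worlds where \<open>\<psi>\<close> is true, so
  \<open>ELKy\<^sup>r\<close> does not notice when all explanations of false formulas are discarded. This operation
  preserves knowing-why models: truth is closed under modus ponens and \<open>\<Lambda>\<close> is valid. An
  announcement, however, can make a false formula true, and its explanations then matter: where
  \<open>p\<close> is true but \<open>K\<^sub>a p\<close> is not, \<open>[p] Ky\<^sub>a K\<^sub>a p\<close> fails once the explanations of false formulas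
  are gone, although it holds if every formula is explained everywhere.
\<close>

definition factive_model :: "('w, 'e, 'a, 'p) model \<Rightarrow> ('w, 'e, 'a, 'p) model" where
  "factive_model M = M\<lparr>adm := \<lambda>t \<phi>. adm M t \<phi> \<inter> {v. sat \<phi> M v}\<rparr>"

lemma factive_model_simps [simp]:
  "worlds (factive_model M) = worlds M"
  "expls (factive_model M) = expls M"
  "unit_expl (factive_model M) = unit_expl M"
  "app (factive_model M) = app M"
  "acc (factive_model M) = acc M"
  "val (factive_model M) = val M"
  by (simp_all add: factive_model_def)

lemma adm_factive_model: "adm (factive_model M) t \<phi> = adm M t \<phi> \<inter> {v. sat \<phi> M v}"
  by (simp add: factive_model_def)

lemma factive_model_in_S5_models:
  assumes "M \<in> S5_models \<Lambda>" and "\<forall>\<phi>\<in>\<Lambda>. valid_over {M} \<phi>"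
  shows "factive_model M \<in> S5_models \<Lambda>"
proof -
  have "adm (factive_model M) t \<phi> \<subseteq> worlds M" if "t \<in> expls M" for t \<phi>
    using assms(1) that unfolding S5_models_def adm_factive_model by blast
  moreover have "adm (factive_model M) (unit_expl M) \<phi> = worlds M" if "\<phi> \<in> \<Lambda>" for \<phi>
    using assms that by (auto simp: S5_models_def valid_over_def adm_factive_model)
  moreover have "adm (factive_model M) s (Imp \<phi> \<psi>) \<inter> adm (factive_model M) t \<phi>
      \<subseteq> adm (factive_model M) (app M s t) \<psi>"
    if "s \<in> expls M" "t \<in> expls M" for s t \<phi> \<psi>
  proof -
    have "adm M s (Imp \<phi> \<psi>) \<inter> adm M t \<phi> \<subseteq> adm M (app M s t) \<psi>"
      using assms(1) that by (simp add: S5_models_def)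
    then show ?thesis
      by (auto simp: adm_factive_model)
  qed
  ultimately show ?thesis
    using assms(1) by (simp add: S5_models_def)
qed

lemma sat_factive_model_iff:
  assumes "\<phi> \<in> L_ELKyR"
  shows "sat \<phi> (factive_model M) w \<longleftrightarrow> sat \<phi> M w"
  using assms by (induction arbitrary: w) (simp_all add: adm_factive_model)

lemma not_equivalent_over_L_ELKyR:
  assumes "M \<in> C" and "factive_model M \<in> C" and "w \<in> worlds M"
    and "sat \<phi> M w" and "\<not> sat \<phi> (factive_model M) w"
    and "\<psi> \<in> L_ELKyR"
  shows "\<not> equivalent_over C \<phi> \<psi>"
proof
  assume "equivalent_over C \<phi> \<psi>"
  then have "sat \<phi> M w \<longleftrightarrow> sat \<psi> M w"
    and "sat \<phi> (factive_model M) w \<longleftrightarrow> sat \<psi> (factive_model M) w"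
    using assms(1-3) by (simp_all add: equivalent_over_def)
  moreover have "sat \<psi> (factive_model M) w \<longleftrightarrow> sat \<psi> M w"
    using assms(6) by (rule sat_factive_model_iff)
  ultimately show False
    using assms(4,5) by simp
qed

definition Ann_Ky_K :: "'a \<Rightarrow> 'p \<Rightarrow> ('a, 'p) fm" where
  "Ann_Ky_K a p = Ann (Atom p) (Ky a (K a (Atom p)))"

lemma Ann_Ky_K_in_L_PAFKy: "Ann_Ky_K a p \<in> L_PAFKy"
  unfolding Ann_Ky_K_def by (intro L_PAFKy.intros)

lemma sat_Ann_Ky_K_iff:
  assumes "w \<in> worlds M" and "w \<in> val M p"
  shows "sat (Ann_Ky_K a p) M w \<longleftrightarrow>
    (\<exists>t\<in>expls M. \<forall>v\<in>worlds M \<inter> val M p. (w, v) \<in> acc M a \<longrightarrow> v \<in> adm M t (K a (Atom p)))"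
  using assms by (simp add: Ann_Ky_K_def restrict_model_def) blast

lemma not_sat_Ann_Ky_K_factive_model:
  assumes "w \<in> worlds M" and "w \<in> val M p" and "(w, w) \<in> acc M a"
    and "\<not> sat (K a (Atom p)) M w"
  shows "\<not> sat (Ann_Ky_K a p) (factive_model M) w"
proof -
  have "w \<notin> adm (factive_model M) t (K a (Atom p))" for t
    using assms(4) by (simp add: adm_factive_model)
  with assms(1-3) show ?thesis
    by (subst sat_Ann_Ky_K_iff) auto
qed

definition all_explained_model :: "'e \<Rightarrow> ('p \<Rightarrow> 'w set) \<Rightarrow> ('w, 'e, 'a, 'p) model" where
  "all_explained_model e V =
     \<lparr>worlds = UNIV, expls = {e}, unit_expl = e, app = \<lambda>_ _. e, acc = \<lambda>_. UNIV,
      adm = \<lambda>_ _. UNIV, val = V\<rparr>"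

lemma all_explained_model_in_S5_models: "all_explained_model e V \<in> S5_models \<Lambda>"
  by (simp add: all_explained_model_def S5_models_def equiv_def refl_on_def sym_def trans_def)

theorem theorem4p5:
  fixes \<Lambda> :: "('a::countable, 'p::{countable, infinite}) fm set"
    and C :: "('w::infinite, 'e::infinite, 'a, 'p) model set"
  assumes "C = S5_models \<Lambda>"
    and "\<forall>\<phi>\<in>\<Lambda>. valid_over C \<phi>"
  shows "\<not> equally_expressive_over C L_PAFKy L_ELKyR \<and>
    (\<exists>\<phi>\<in>L_PAFKy. \<forall>\<psi>\<in>L_ELKyR. \<not> equivalent_over C \<phi> \<psi>)"
proof -
  fix w :: 'w and e :: 'e and a :: 'a and p :: 'p
  obtain u where "u \<noteq> w"
    using ex_new_if_finite[OF infinite_UNIV, of "{w}"] by auto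
  define M :: "('w, 'e, 'a, 'p) model" where "M = all_explained_model e (\<lambda>_. {w})"
  have "M \<in> C"
    unfolding assms(1) M_def by (rule all_explained_model_in_S5_models)
  moreover from this have "factive_model M \<in> C"
    using assms by (auto intro!: factive_model_in_S5_models simp: valid_over_def)
  moreover have "w \<in> worlds M"
    by (simp add: M_def all_explained_model_def)
  moreover from this have "sat (Ann_Ky_K a p) M w"
    by (subst sat_Ann_Ky_K_iff) (simp_all add: M_def all_explained_model_def)
  moreover have "\<not> sat (Ann_Ky_K a p) (factive_model M) w"
    using \<open>u \<noteq> w\<close>
    by (intro not_sat_Ann_Ky_K_factive_model) (auto simp: M_def all_explained_model_def)
  ultimately have "\<not> equivalent_over C (Ann_Ky_K a p) \<psi>" if "\<psi> \<in> L_ELKyR" for \<psi>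
    using that by (rule not_equivalent_over_L_ELKyR)
  moreover have "Ann_Ky_K a p \<in> L_PAFKy"
    by (rule Ann_Ky_K_in_L_PAFKy)
  ultimately show ?thesis
    unfolding equally_expressive_over_def by blast
qed

end
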